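(* Let $k\ge1$, let $\beta_1,\ldots,\beta_k$ be negative real numbers, let $(\alpha_n)$ be a sequence of real numbers with $\alpha_n\to\infty$, and let $\mathbb{P}^{(n)}$ be the directed exponential random graph measure with outward-star parameters $\beta_p^{(n)}=\beta_p\alpha_n$, $p=1,\ldots,k$ (defined in the context). Assume that $\lim_{n\to\infty}ne^{\alpha_n\beta_1}=0$ and $\lim_{n\to\infty}\frac{\alpha_n}{n}=0$. Then for every fixed vertex $i$, $$\lim_{n\to\infty}\frac{\mathbb{P}^{(n)}(X_{1i}=1)}{e^{\alpha_n\beta_1}}=1.$$
   Context: Directed graphs $G_n$ on the vertex set $\{1,\ldots,n\}$, with loops allowed, are represented by matrices $X_n=(X_{ij})_{1\le i,j\le n}$ with $X_{ij}\in\{0,1\}$, where $X_{ij}=1$ if and only if there is a directed edge from $i$ to $j$. For $p\ge1$ the directed $p$-star homomorphism density is $$s_p(X_n)=n^{-p-1}\sum_{1\le i,j_1,\ldots,j_p\le n}X_{ij_1}X_{ij_2}\cdots X_{ij_p}=n^{-p-1}\sum_{i=1}^n\left(\sum_{j=1}^nX_{ij}\right)^p.$$ The measure $\mathbb{P}^{(n)}$ on $\{0,1\}^{n\times n}$ is $$\mathbb{P}^{(n)}(G_n)=Z_n^{-1}\exp\left[n^2\sum_{p=1}^k\beta_p^{(n)}s_p(X_n)\right],\qquad \beta_p^{(n)}=\beta_p\alpha_n,$$ where $Z_n=\sum_{X_n\in\{0,1\}^{n\times n}}\exp\left[n^2\sum_{p=1}^k\beta_p^{(n)}s_p(X_n)\right]$.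 *)

theory Defs
  imports "HOL-Probability.Probability"
begin

text \<open>
  Directed graphs on \<open>{1..n}\<close>, loops allowed, as 0/1 matrices; the matrices are extensional
  (\<open>undefined\<close> outside \<open>{1..n}\<close>), so that there are exactly \<open>2 ^ (n * n)\<close> of them.
\<close>
definition digraph_matrices :: "nat \<Rightarrow> (nat \<Rightarrow> nat \<Rightarrow> real) set" where
  "digraph_matrices n = {1..n} \<rightarrow>\<^sub>E ({1..n} \<rightarrow>\<^sub>E {0, 1})"

text \<open>The inner sum ranges over the tuples \<open>(j 1, \<dots>, j p)\<close> in \<open>{1..n} ^ p\<close>.\<close>
definition star_density :: "nat \<Rightarrow> nat \<Rightarrow> (nat \<Rightarrow> nat \<Rightarrow> real) \<Rightarrow> real" where
  "star_density n p X =
     (\<Sum>i\<in>{1..n}. \<Sum>j\<in>{1..p} \<rightarrow>\<^sub>E {1..n}. \<Prod>l\<in>{1..p}. X i (j l)) / real n ^ (p + 1)"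

lemma star_density_eq_sum_power:
  "star_density n p X = (\<Sum>i\<in>{1..n}. (\<Sum>j\<in>{1..n}. X i j) ^ p) / real n ^ (p + 1)"
proof -
  have "(\<Sum>j\<in>{1..p} \<rightarrow>\<^sub>E {1..n}. \<Prod>l\<in>{1..p}. X i (j l)) = (\<Sum>j\<in>{1..n}. X i j) ^ p" for i
    by (subst prod_sum_PiE[symmetric]) auto
  then show ?thesis
    by (simp add: star_density_def)
qed

definition ergm_weight :: "nat \<Rightarrow> nat \<Rightarrow> (nat \<Rightarrow> real) \<Rightarrow> (nat \<Rightarrow> nat \<Rightarrow> real) \<Rightarrow> real" where
  "ergm_weight k n b X = exp (real n ^ 2 * (\<Sum>p = 1..k. b p * star_density n p X))"

definition ergm_partition :: "nat \<Rightarrow> nat \<Rightarrow> (nat \<Rightarrow> real) \<Rightarrow> real" where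
  "ergm_partition k n b = (\<Sum>X\<in>digraph_matrices n. ergm_weight k n b X)"

definition ergm :: "nat \<Rightarrow> nat \<Rightarrow> (nat \<Rightarrow> real) \<Rightarrow> (nat \<Rightarrow> nat \<Rightarrow> real) measure" where
  "ergm k n b =
     point_measure (digraph_matrices n) (\<lambda>X. ennreal (ergm_weight k n b X / ergm_partition k n b))"

lemma finite_digraph_matrices: "finite (digraph_matrices n)"
  by (simp add: digraph_matrices_def finite_PiE)

lemma digraph_matrices_nonempty: "digraph_matrices n \<noteq> {}"
  by (simp add: digraph_matrices_def PiE_eq_empty_iff)

lemma ergm_partition_pos: "ergm_partition k n b > 0"
  unfolding ergm_partition_def
  by (intro sum_pos) (auto simp: finite_digraph_matrices digraph_matrices_nonempty ergm_weight_def)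

lemma prob_space_ergm: "prob_space (ergm k n b)"
proof -
  have "(\<Sum>X\<in>digraph_matrices n. ergm_weight k n b X / ergm_partition k n b) = 1"
    using ergm_partition_pos[of k n b]
    by (simp add: ergm_partition_def flip: sum_divide_distrib)
  then have "(\<Sum>X\<in>digraph_matrices n. ennreal (ergm_weight k n b X / ergm_partition k n b)) = 1"
    using ergm_partition_pos[of k n b]
    by (subst sum_ennreal) (auto simp: ergm_weight_def)
  then show ?thesis
    by (intro prob_spaceI)
       (simp add: ergm_def space_point_measure emeasure_point_measure_finite
          finite_digraph_matrices)
qed

end

theory Submission
  imports Defs
begin

text \<open>
  The Hamiltonian is a sum over rows, so the rows are independent, and a row \<open>x\<close> has weight
  \<open>exp (b 1 * d + \<dots>)\<close> with \<open>d = (\<Sum>j. x j)\<close>. All parameters are nonpositive, so up to the linear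
  term this weight is at most that of independent edges with odds \<open>e = exp (b 1)\<close>. Keeping only
  the zero row in the row partition function and only the unit row in the numerator gives, with
  matching upper bounds, \<open>P(X 1 i = 1) / e\<close> between \<open>exp ((\<Sum>p\<ge>2. b p) / n) / (1 + e) ^ n\<close> and
  \<open>(1 + e) ^ n\<close>. Both bounds tend to 1, since \<open>1 \<le> (1 + e) ^ n \<le> exp (n * e)\<close>.
\<close>

section \<open>Factorisation of the measure over rows\<close>

definition rows :: "nat \<Rightarrow> (nat \<Rightarrow> real) set" where
  "rows n = {1..n} \<rightarrow>\<^sub>E {0, 1}"

text \<open>With \<open>d\<close> the row sum, the term for \<open>p\<close> is
  \<open>b p * d ^ p / n ^ (p - 1)\<close> when \<open>n\<close> is positive; the powers stay
  uncancelled to match \<open>star_density_eq_sum_power\<close> term by term.\<close>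

definition row_weight :: "nat \<Rightarrow> nat \<Rightarrow> (nat \<Rightarrow> real) \<Rightarrow> (nat \<Rightarrow> real) \<Rightarrow> real" where
  "row_weight k n b x =
     exp (\<Sum>p = 1..k. b p * (real n ^ 2 * (\<Sum>j\<in>{1..n}. x j) ^ p / real n ^ (p + 1)))"

text \<open>Fixing one coordinate leaves a product set, so sums over it still factor. This serves
  both for the rows of a matrix and for the entries of a row.\<close>

lemma PiE_restrict_component:
  assumes "i \<in> I"
  shows "{f \<in> PiE I B. f i \<in> C} = PiE I (\<lambda>j. if j = i then B j \<inter> C else B j)" (is "_ = PiE I ?B")
proof (rule set_eqI)
  fix f
  have "(\<forall>j\<in>I. f j \<in> ?B j) \<longleftrightarrow> (\<forall>j\<in>I. f j \<in> B j) \<and> f i \<in> C"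
    using assms by (metis IntD1 IntD2 IntI)
  then show "f \<in> {f \<in> PiE I B. f i \<in> C} \<longleftrightarrow> f \<in> PiE I ?B"
    unfolding mem_Collect_eq PiE_iff by blast
qed

lemma finite_rows: "finite (rows n)"
  by (simp add: rows_def finite_PiE)

lemma row_weight_pos: "row_weight k n b x > 0"
  by (simp add: row_weight_def)

lemma ergm_weight_eq_prod: "ergm_weight k n b X = (\<Prod>r\<in>{1..n}. row_weight k n b (X r))"
proof -
  have "real n ^ 2 * (\<Sum>p = 1..k. b p * star_density n p X) =
      (\<Sum>p = 1..k. \<Sum>r\<in>{1..n}. b p * (real n ^ 2 * (\<Sum>j\<in>{1..n}. X r j) ^ p / real n ^ (p + 1)))"
    unfolding star_density_eq_sum_power sum_distrib_left sum_divide_distrib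
    by (intro sum.cong) (auto simp: mult_ac)
  also have "\<dots> = (\<Sum>r\<in>{1..n}. \<Sum>p = 1..k.
      b p * (real n ^ 2 * (\<Sum>j\<in>{1..n}. X r j) ^ p / real n ^ (p + 1)))"
    by (rule sum.swap)
  finally show ?thesis
    by (simp add: ergm_weight_def row_weight_def exp_sum)
qed

text \<open>Letting \<open>B\<close> depend on the row covers both the partition function and the
  event that constrains a single row.\<close>

lemma sum_ergm_weight_PiE:
  assumes "\<And>r. r \<in> {1..n} \<Longrightarrow> finite (B r)"
  shows "(\<Sum>X\<in>PiE {1..n} B. ergm_weight k n b X) = (\<Prod>r\<in>{1..n}. \<Sum>x\<in>B r. row_weight k n b x)"
  unfolding ergm_weight_eq_prod using assms by (subst prod_sum_PiE) auto

lemma measure_ergm: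
  assumes "A \<subseteq> digraph_matrices n"
  shows "measure (ergm k n b) A = (\<Sum>X\<in>A. ergm_weight k n b X) / ergm_partition k n b"
proof -
  have nn: "ergm_weight k n b X / ergm_partition k n b \<ge> 0" for X
    using ergm_partition_pos[of k n b] by (simp add: ergm_weight_def)
  have "emeasure (ergm k n b) A = (\<Sum>X\<in>A. ennreal (ergm_weight k n b X / ergm_partition k n b))"
    unfolding ergm_def by (rule emeasure_point_measure_finite[OF finite_digraph_matrices assms])
  also have "\<dots> = ennreal (\<Sum>X\<in>A. ergm_weight k n b X / ergm_partition k n b)"
    using nn by (subst sum_ennreal) auto
  finally show ?thesis
    using nn by (simp add: measure_def sum_nonneg sum_divide_distrib)
qed

text \<open>The rows other than \<open>r\<close> contribute the same factors to numerator and
  partition function; these cancel and leave a one-row quotient.\<close>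

lemma measure_ergm_edge:
  assumes "r \<in> {1..n}"
  shows "measure (ergm k n b) {X \<in> digraph_matrices n. X r i = 1} =
    (\<Sum>x\<in>{x \<in> rows n. x i = 1}. row_weight k n b x) / (\<Sum>x\<in>rows n. row_weight k n b x)"
proof -
  define Z where "Z = (\<Sum>x\<in>rows n. row_weight k n b x)"
  define A where "A = (\<Sum>x\<in>{x \<in> rows n. x i = 1}. row_weight k n b x)"
  have "rows n \<noteq> {}"
    by (simp add: rows_def PiE_eq_empty_iff)
  then have "Z > 0"
    unfolding Z_def by (intro sum_pos row_weight_pos finite_rows)
  define B where "B = (\<lambda>s. if s = r then rows n \<inter> {x. x i = 1} else rows n)"
  have "{X \<in> digraph_matrices n. X r i = 1} = PiE {1..n} B"
    using PiE_restrict_component[OF assms, of "\<lambda>_. rows n" "{x. x i = 1}"]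
    by (simp only: digraph_matrices_def rows_def[symmetric] B_def mem_Collect_eq)
  then have "(\<Sum>X\<in>{X \<in> digraph_matrices n. X r i = 1}. ergm_weight k n b X) =
      (\<Prod>s\<in>{1..n}. \<Sum>x\<in>B s. row_weight k n b x)"
    by (simp only:) (rule sum_ergm_weight_PiE, simp add: B_def finite_rows)
  also have "\<dots> = A * (\<Prod>s\<in>{1..n} - {r}. Z)"
    using assms by (subst prod.remove[of _ r]) (auto simp: B_def A_def Z_def Int_def intro!: prod.cong)
  finally have num: "(\<Sum>X\<in>{X \<in> digraph_matrices n. X r i = 1}. ergm_weight k n b X) =
    A * (\<Prod>s\<in>{1..n} - {r}. Z)" .
  have "ergm_partition k n b = (\<Prod>s\<in>{1..n}. Z)"
    unfolding ergm_partition_def digraph_matrices_def rows_def[symmetric] Z_def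
    by (rule sum_ergm_weight_PiE) (rule finite_rows)
  also have "\<dots> = Z * (\<Prod>s\<in>{1..n} - {r}. Z)"
    using assms by (subst prod.remove[of _ r]) auto
  finally have den: "ergm_partition k n b = Z * (\<Prod>s\<in>{1..n} - {r}. Z)" .
  show ?thesis
    using \<open>Z > 0\<close> by (subst measure_ergm) (auto simp: num den A_def Z_def)
qed

section \<open>Bounds for a single row at fixed \<open>n\<close>\<close>

context
  fixes k n :: nat and b :: "nat \<Rightarrow> real"
  assumes k: "k \<ge> 1" and n: "n \<ge> 1" and b: "\<And>p. p \<in> {1..k} \<Longrightarrow> b p \<le> 0"
begin

lemma row_weight_le:
  assumes "x \<in> rows n"
  shows "row_weight k n b x \<le> (\<Prod>j\<in>{1..n}. exp (b 1 * x j))"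
proof -
  define t where "t = (\<lambda>p. b p * (real n ^ 2 * (\<Sum>j\<in>{1..n}. x j) ^ p / real n ^ (p + 1)))"
  have "x j \<ge> 0" if "j \<in> {1..n}" for j
    using PiE_mem[OF assms[unfolded rows_def] that] by auto
  then have "(\<Sum>j\<in>{1..n}. x j) \<ge> 0"
    by (rule sum_nonneg)
  then have "t p \<le> 0" if "p \<in> {1..k}" for p
    unfolding t_def using b[OF that] by (intro mult_nonpos_nonneg) auto
  then have "(\<Sum>p = Suc 1..k. t p) \<le> 0"
    by (intro sum_nonpos) auto
  moreover have "(\<Sum>p = 1..k. t p) = t 1 + (\<Sum>p = Suc 1..k. t p)"
    using k by (rule sum.atLeast_Suc_atMost)
  moreover have "t 1 = (\<Sum>j\<in>{1..n}. b 1 * x j)"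
    using n by (simp add: t_def power2_eq_square flip: sum_distrib_left)
  ultimately show ?thesis
    by (simp add: row_weight_def t_def flip: exp_sum)
qed

lemma sum_row_weight_le: "(\<Sum>x\<in>rows n. row_weight k n b x) \<le> (1 + exp (b 1)) ^ n"
proof -
  have "(\<Sum>x\<in>rows n. row_weight k n b x) \<le> (\<Sum>x\<in>rows n. \<Prod>j\<in>{1..n}. exp (b 1 * x j))"
    by (intro sum_mono row_weight_le)
  also have "\<dots> = (\<Prod>j\<in>{1..n}. \<Sum>y\<in>{0, 1}. exp (b 1 * y))"
    unfolding rows_def by (subst prod_sum_PiE) auto
  finally show ?thesis by simp
qed

lemma sum_row_weight_ge: "(\<Sum>x\<in>rows n. row_weight k n b x) \<ge> 1"
proof -
  define x :: "nat \<Rightarrow> real" where "x = restrict (\<lambda>_. 0) {1..n}"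
  have "row_weight k n b x = 1"
    \<comment> \<open>The powers of the zero row sum vanish because \<open>p\<close> starts at
      1.\<close>
    by (auto simp: row_weight_def x_def power_0_left intro!: sum.neutral)
  moreover have "row_weight k n b x \<le> (\<Sum>x\<in>rows n. row_weight k n b x)"
    by (intro member_le_sum finite_rows less_imp_le[OF row_weight_pos])
      (auto simp: rows_def x_def)
  ultimately show ?thesis by simp
qed

lemma sum_row_weight_edge_le:
  assumes "i \<in> {1..n}"
  shows "(\<Sum>x\<in>{x \<in> rows n. x i = 1}. row_weight k n b x) \<le> exp (b 1) * (1 + exp (b 1)) ^ n"
proof -
  define B where "B = (\<lambda>j. if j = i then {0, 1} \<inter> {1} else {0, 1 :: real})"
  have *: "{x \<in> rows n. x i = 1} = PiE {1..n} B"
    using PiE_restrict_component[OF assms, of "\<lambda>_. {0, 1}" "{1}"]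
    by (simp add: rows_def B_def)
  have "(\<Sum>x\<in>{x \<in> rows n. x i = 1}. row_weight k n b x) \<le>
      (\<Sum>x\<in>{x \<in> rows n. x i = 1}. \<Prod>j\<in>{1..n}. exp (b 1 * x j))"
    by (intro sum_mono row_weight_le) auto
  also have "\<dots> = (\<Prod>j\<in>{1..n}. \<Sum>y\<in>B j. exp (b 1 * y))"
    unfolding * by (subst prod_sum_PiE) (auto simp: B_def)
  also have "\<dots> = exp (b 1) * (\<Prod>j\<in>{1..n} - {i}. 1 + exp (b 1))"
    using assms by (subst prod.remove[of _ i]) (auto simp: B_def intro!: prod.cong)
  also have "\<dots> = exp (b 1) * (1 + exp (b 1)) ^ (n - 1)"
    using assms by simp
  \<comment> \<open>The factor lost at the fixed entry is put back, being at least 1, so that the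
    same power bounds numerator and denominator.\<close>
  also have "\<dots> \<le> exp (b 1) * (1 + exp (b 1)) ^ n"
    by (intro mult_left_mono power_increasing) auto
  finally show ?thesis .
qed

text \<open>The row whose only edge goes to \<open>i\<close> already suffices: its row sum is 1, and
  for \<open>p \<ge> 2\<close> its exponent carries \<open>b p\<close> with a factor of at most
  \<open>1 / n\<close>.\<close>

lemma sum_row_weight_edge_ge:
  assumes "i \<in> {1..n}"
  shows "(\<Sum>x\<in>{x \<in> rows n. x i = 1}. row_weight k n b x) \<ge>
    exp (b 1) * exp ((\<Sum>p = 2..k. b p) / n)"
proof -
  define x :: "nat \<Rightarrow> real" where "x = restrict (\<lambda>j. if j = i then 1 else 0) {1..n}"
  have "(\<Sum>j\<in>{1..n}. x j) = (\<Sum>j\<in>{1..n}. if j = i then 1 else 0)"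
    by (intro sum.cong) (auto simp: x_def)
  then have d: "(\<Sum>j\<in>{1..n}. x j) = 1"
    using assms by simp
  define t where "t = (\<lambda>p. b p * (real n ^ 2 / real n ^ (p + 1)))"
  have "b p / n \<le> t p" if p: "p \<in> {2..k}" for p
  proof -
    have "real n ^ 3 \<le> real n ^ (p + 1)"
      using n p by (intro power_increasing) auto
    then have "real n ^ 2 / real n ^ (p + 1) \<le> real n ^ 2 / real n ^ 3"
      using n by (intro divide_left_mono) auto
    also have "\<dots> = 1 / n"
      using n by (simp add: power2_eq_square power3_eq_cube)
    finally show ?thesis
      \<comment> \<open>Multiplication by \<open>b p \<le> 0\<close> reverses the
        inequality.\<close>
      unfolding t_def using mult_left_mono_neg[of _ _ "b p"] b[of p] p by fastforce
  qed
  then have "(\<Sum>p = 2..k. b p / n) \<le> (\<Sum>p = 2..k. t p)"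
    by (rule sum_mono)
  moreover have "(\<Sum>p = 1..k. t p) = t 1 + (\<Sum>p = 2..k. t p)"
    using sum.atLeast_Suc_atMost[OF k, of t] by (simp add: numeral_2_eq_2)
  moreover have "t 1 = b 1"
    using n by (simp add: t_def power2_eq_square)
  ultimately have "b 1 + (\<Sum>p = 2..k. b p) / n \<le> (\<Sum>p = 1..k. t p)"
    by (simp add: sum_divide_distrib)
  then have "exp (b 1) * exp ((\<Sum>p = 2..k. b p) / n) \<le> row_weight k n b x"
    unfolding row_weight_def d t_def by (simp flip: exp_add)
  also have "\<dots> \<le> (\<Sum>x\<in>{x \<in> rows n. x i = 1}. row_weight k n b x)"
    using assms by (intro member_le_sum less_imp_le[OF row_weight_pos])
      (auto simp: rows_def x_def finite_PiE split: if_splits)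
  finally show ?thesis .
qed

text \<open>The powers of \<open>1 + exp (b 1)\<close> are replaced by
  \<open>exp (n * exp (b 1))\<close>, whose exponent is the quantity assumed to vanish in the
  limit.\<close>

lemma edge_probability_bounds:
  assumes "i \<in> {1..n}"
  shows "measure (ergm k n b) {X \<in> digraph_matrices n. X 1 i = 1} / exp (b 1) \<in>
    {exp ((\<Sum>p = 2..k. b p) / n) / exp (n * exp (b 1)) .. exp (n * exp (b 1))}"
proof -
  define Z where "Z = (\<Sum>x\<in>rows n. row_weight k n b x)"
  define A where "A = (\<Sum>x\<in>{x \<in> rows n. x i = 1}. row_weight k n b x)"
  have "(1 + exp (b 1)) ^ n \<le> exp (exp (b 1)) ^ n"
    by (intro power_mono exp_ge_add_one_self) (auto intro: add_nonneg_nonneg)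
  then have e: "(1 + exp (b 1)) ^ n \<le> exp (n * exp (b 1))"
    by (simp flip: exp_of_nat_mult)
  have Z: "1 \<le> Z" "Z \<le> exp (n * exp (b 1))"
    using sum_row_weight_ge sum_row_weight_le e unfolding Z_def by linarith+
  have "A \<le> exp (b 1) * (1 + exp (b 1)) ^ n"
    unfolding A_def by (rule sum_row_weight_edge_le[OF assms])
  also have "\<dots> \<le> exp (b 1) * exp (n * exp (b 1))"
    using e by simp
  finally have A: "A / exp (b 1) \<le> exp (n * exp (b 1))"
    by (simp add: field_simps)
  have A': "exp ((\<Sum>p = 2..k. b p) / n) \<le> A / exp (b 1)"
    using sum_row_weight_edge_ge[OF assms] by (simp add: A_def field_simps)
  have "A / exp (b 1) / Z \<le> exp (n * exp (b 1)) / 1"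
    using A Z by (intro frac_le) auto
  moreover have "exp ((\<Sum>p = 2..k. b p) / n) / exp (n * exp (b 1)) \<le> A / exp (b 1) / Z"
    using A' Z order_trans[OF exp_ge_zero A'] by (intro frac_le) auto
  moreover have "measure (ergm k n b) {X \<in> digraph_matrices n. X 1 i = 1} = A / Z"
    unfolding A_def Z_def using n by (intro measure_ergm_edge) auto
  ultimately show ?thesis
    by (simp add: mult.commute)
qed

end

theorem theorem3p1:
  fixes k :: nat and \<beta> :: "nat \<Rightarrow> real" and \<alpha> :: "nat \<Rightarrow> real" and i :: nat
  assumes "k \<ge> 1"
    and "\<And>p. p \<in> {1..k} \<Longrightarrow> \<beta> p < 0"
    and "filterlim \<alpha> at_top sequentially"
    and "(\<lambda>n. real n * exp (\<alpha> n * \<beta> 1)) \<longlonglongrightarrow> 0"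
    and "(\<lambda>n. \<alpha> n / real n) \<longlonglongrightarrow> 0"
    and "i \<ge> 1"
  shows "(\<lambda>n. measure (ergm k n (\<lambda>p. \<beta> p * \<alpha> n)) {X \<in> digraph_matrices n. X 1 i = 1}
              / exp (\<alpha> n * \<beta> 1)) \<longlonglongrightarrow> 1"
proof -
  \<comment> \<open>The bounds need nonpositive parameters, hence \<open>\<alpha> n \<ge> 0\<close>,
    and a vertex \<open>i\<close> in \<open>{1..n}\<close>, hence \<open>n \<ge> i\<close>; both
    hold eventually.\<close>
  have "eventually (\<lambda>n. \<alpha> n \<ge> 0) sequentially"
    using assms(3) by (simp add: filterlim_at_top)
  then have bounds: "eventually (\<lambda>n.
      measure (ergm k n (\<lambda>p. \<beta> p * \<alpha> n)) {X \<in> digraph_matrices n. X 1 i = 1} / exp (\<alpha> n * \<beta> 1) \<in>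
      {exp ((\<Sum>p = 2..k. \<beta> p) * (\<alpha> n / n)) / exp (n * exp (\<alpha> n * \<beta> 1)) ..
       exp (n * exp (\<alpha> n * \<beta> 1))}) sequentially"
    using eventually_ge_at_top[of i]
  proof eventually_elim
    case (elim n)
    have "\<beta> p * \<alpha> n \<le> 0" if "p \<in> {1..k}" for p
      using assms(2)[OF that] elim by (intro mult_nonpos_nonneg) auto
    from edge_probability_bounds[of k n "\<lambda>p. \<beta> p * \<alpha> n" i, OF assms(1) _ this]
    show ?case
      using elim \<open>i \<ge> 1\<close> by (simp add: mult.commute[of "\<alpha> n"] flip: sum_distrib_right)
  qed
  \<comment> \<open>The first exponent is a constant times \<open>\<alpha> n / n\<close>, the second
    is \<open>n * exp (\<alpha> n * \<beta> 1)\<close>; both tend to 0 by assumption.\<close>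
  have lower: "(\<lambda>n. exp ((\<Sum>p = 2..k. \<beta> p) * (\<alpha> n / n)) / exp (n * exp (\<alpha> n * \<beta> 1)))
      \<longlonglongrightarrow> 1"
    by (rule tendsto_eq_intros assms refl | simp)+
  have upper: "(\<lambda>n. exp (n * exp (\<alpha> n * \<beta> 1))) \<longlonglongrightarrow> 1"
    by (rule tendsto_eq_intros assms refl | simp)+
  show ?thesis
    by (rule tendsto_sandwich[OF _ _ lower upper]; rule eventually_mono[OF bounds])
      (simp_all only: atLeastAtMost_iff)
qed

end
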